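(* Let $\mu$ be a probabilistic frame for $\mathbb{R}^n$ and let $\nu\in\mathcal{P}_2(\mathbb{R}^n)$ be a probabilistic dual frame of $\mu$ with respect to $\gamma_{12}\in\Gamma(\mu,\nu)$. Suppose $\eta\in\mathcal{P}_2(\mathbb{R}^n)$ and $\gamma_{23}\in\Gamma(\nu,\eta)$. Then there exists $\tilde{\pi}\in\mathcal{P}(\mathbb{R}^n\times\mathbb{R}^n\times\mathbb{R}^n)$ with marginals $\gamma_{12}$ and $\gamma_{23}$ (that is, its pushforward under $(\mathbf{x},\mathbf{y},\mathbf{z})\mapsto(\mathbf{x},\mathbf{y})$ is $\gamma_{12}$ and its pushforward under $(\mathbf{x},\mathbf{y},\mathbf{z})\mapsto(\mathbf{y},\mathbf{z})$ is $\gamma_{23}$). Moreover, for such a $\tilde{\pi}$, if $$\sigma := \int_{\mathbb{R}^n\times\mathbb{R}^n\times\mathbb{R}^n}\Vert\mathbf{y}\Vert\,\Vert\mathbf{x}-\mathbf{z}\Vert\,d\tilde{\pi}(\mathbf{x},\mathbf{y},\mathbf{z})<1,$$ then $\eta$ is a probabilistic frame for $\mathbb{R}^n$ with bounds $\frac{(1-\sigma)^2}{M_2(\nu)}$ and $M_2(\eta)$; and if $D>0$ is an upper frame bound for $\nu$, then $\eta$ is a probabilistic frame for $\mathbb{R}^n$ with bounds $\frac{(1-\sigma)^2}{D}$ and $M_2(\eta)$.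
   Context: $\mathcal{P}(X)$ is the set of Borel probability measures on $X$ and $\Vert\cdot\Vert$ is the Euclidean norm. The second moment of $\mu\in\mathcal{P}(\mathbb{R}^n)$ is $M_2(\mu) := \int_{\mathbb{R}^n}\Vert \mathbf{x}\Vert^2 d\mu(\mathbf{x})$, and $\mathcal{P}_2(\mathbb{R}^n)$ is the set of $\mu \in \mathcal{P}(\mathbb{R}^n)$ with $M_2(\mu)<+\infty$. A measure $\mu\in\mathcal{P}(\mathbb{R}^n)$ is a probabilistic frame for $\mathbb{R}^n$ with (frame) bounds $A$ and $B$, where $0<A\le B<\infty$, if for every $\mathbf{x}\in\mathbb{R}^n$, $A\Vert\mathbf{x}\Vert^2 \le \int_{\mathbb{R}^n} |\langle \mathbf{x},\mathbf{y}\rangle|^2 d\mu(\mathbf{y}) \le B\Vert\mathbf{x}\Vert^2$; $A$ is called a lower and $B$ an upper frame bound (the bounds need not be optimal). It is called a probabilistic frame if such $A,B$ exist. $\Gamma(\mu,\nu)$ denotes the set of transport couplings of $\mu$ and $\nu$: Borel probability measures $\gamma$ on $\mathbb{R}^n\times\mathbb{R}^n$ with first marginal $\mu$ and second marginal $\nu$. If $\mu$ is a probabilistic frame for $\mathbb{R}^n$, then $\nu\in\mathcal{P}_2(\mathbb{R}^n)$ is a probabilistic dual frame of $\mu$ with respect to $\gamma\in\Gamma(\mu,\nu)$ if $\int_{\mathbb{R}^n\times\mathbb{R}^n}\mathbf{x}\mathbf{y}^t\,d\gamma(\mathbf{x},\mathbf{y})=\mathbf{Id}$, the $n\times n$ identity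 matrix (vectors are columns and $^t$ denotes transpose). *)

theory Defs
  imports "HOL-Probability.Probability"
begin

definition borel_probs :: "'a::topological_space measure set" where
  "borel_probs = {\<mu>. sets \<mu> = sets borel \<and> prob_space \<mu>}"

definition second_moment :: "(real ^ 'n) measure \<Rightarrow> ennreal" where
  "second_moment \<mu> = (\<integral>\<^sup>+ x. ennreal ((norm x)\<^sup>2) \<partial>\<mu>)"

definition borel_probs2 :: "(real ^ 'n) measure set" where
  "borel_probs2 = {\<mu> \<in> borel_probs. second_moment \<mu> < \<infinity>}"

(* Extended nonnegative integrals: the upper bound then includes integrability. *)
definition prob_frame_bounds :: "(real ^ 'n) measure \<Rightarrow> real \<Rightarrow> real \<Rightarrow> bool" where
  "prob_frame_bounds \<mu> A B \<longleftrightarrow>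
     \<mu> \<in> borel_probs \<and> 0 < A \<and> A \<le> B \<and>
     (\<forall>x. ennreal (A * (norm x)\<^sup>2) \<le> (\<integral>\<^sup>+ y. ennreal (\<bar>x \<bullet> y\<bar>\<^sup>2) \<partial>\<mu>) \<and>
          (\<integral>\<^sup>+ y. ennreal (\<bar>x \<bullet> y\<bar>\<^sup>2) \<partial>\<mu>) \<le> ennreal (B * (norm x)\<^sup>2))"

definition prob_frame :: "(real ^ 'n) measure \<Rightarrow> bool" where
  "prob_frame \<mu> \<longleftrightarrow> (\<exists>A B. prob_frame_bounds \<mu> A B)"

definition upper_frame_bound :: "(real ^ 'n) measure \<Rightarrow> real \<Rightarrow> bool" where
  "upper_frame_bound \<mu> B \<longleftrightarrow> (\<exists>A. prob_frame_bounds \<mu> A B)"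

definition couplings ::
    "(real ^ 'n) measure \<Rightarrow> (real ^ 'n) measure \<Rightarrow> ((real ^ 'n) \<times> (real ^ 'n)) measure set" where
  "couplings \<mu> \<nu> =
     {\<gamma> \<in> borel_probs. distr \<gamma> borel fst = \<mu> \<and> distr \<gamma> borel snd = \<nu>}"

definition prob_dual_frame ::
    "(real ^ 'n) measure \<Rightarrow> (real ^ 'n) measure \<Rightarrow> ((real ^ 'n) \<times> (real ^ 'n)) measure \<Rightarrow> bool" where
  "prob_dual_frame \<mu> \<nu> \<gamma> \<longleftrightarrow>
     prob_frame \<mu> \<and> \<nu> \<in> borel_probs2 \<and> \<gamma> \<in> couplings \<mu> \<nu> \<and>
     has_bochner_integral \<gamma>
       (\<lambda>(x, y). (columnvector x :: real ^ 1 ^ 'n) ** transpose (columnvector y)) (mat 1)"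

definition gluings ::
    "((real ^ 'n) \<times> (real ^ 'n)) measure \<Rightarrow> ((real ^ 'n) \<times> (real ^ 'n)) measure
      \<Rightarrow> ((real ^ 'n) \<times> (real ^ 'n) \<times> (real ^ 'n)) measure set" where
  "gluings \<gamma>12 \<gamma>23 =
     {\<pi> \<in> borel_probs. distr \<pi> borel (\<lambda>(x, y, z). (x, y)) = \<gamma>12 \<and>
                      distr \<pi> borel (\<lambda>(x, y, z). (y, z)) = \<gamma>23}"

end

theory Submission
  imports Defs
begin

text \<open>
  Existence of the gluing. Two couplings that share the marginal \<open>\<nu>\<close> are glued by making the third
  component conditionally independent of the first one given the second. Regular conditional
  probabilities are avoided by attaching independent uniform noise: a real variable \<open>r\<close> can be
  reproduced in law, jointly with \<open>y\<close>, as \<open>T(y, u)\<close> with \<open>u\<close> uniform and independent of \<open>y\<close>, where \<open>T\<close>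
  is the quantile function of the conditional distribution of \<open>r\<close> given \<open>y\<close> (\<open>noise_outsourcing\<close>).
  The same \<open>T\<close> applied to the second component of the other coupling yields a real third component
  (\<open>gluing_real\<close>). A vector is attached coordinate by coordinate: after each step, the coordinates already
  attached join \<open>y\<close> in the part along which the next one is glued (\<open>gluing\<close>).

  Frame bounds. The upper bound is the Cauchy-Schwarz inequality \<open>(x \<bullet> z)\<^sup>2 \<le> \<parallel>x\<parallel>\<^sup>2 \<parallel>z\<parallel>\<^sup>2\<close>.
  For the lower bound, duality says that the integral of \<open>(x \<bullet> a) (b \<bullet> x)\<close> is \<open>\<parallel>x\<parallel>\<^sup>2\<close>. Replacing
  \<open>a\<close> by the third component \<open>c\<close> of the gluing costs at most \<open>\<sigma> \<parallel>x\<parallel>\<^sup>2\<close>, so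
  \<open>(1 - \<sigma>) \<parallel>x\<parallel>\<^sup>2\<close> is at most the integral of \<open>(x \<bullet> c) (b \<bullet> x)\<close>, which is controlled by the frame integrals
  of \<open>\<nu>\<close> and \<open>\<eta>\<close> (\<open>frame_lower_bound\<close>). This works with every \<open>D > 0\<close> that bounds the
  frame integral of \<open>\<nu>\<close> from above; the second moment of \<open>\<nu>\<close> is one such constant, once it is
  known to be positive (\<open>dual_second_moment_pos\<close>).
\<close>

section \<open>Comparing measures\<close>

text \<open>On the set where \<open>f \<le> g\<close> the densities \<open>f\<close> and \<open>min f g\<close> agree, and on its complement the
hypothesis bounds the measure with density \<open>f\<close> by the one with density \<open>g = min f g\<close>. Hence \<open>f\<close> and
\<open>min f g\<close> are densities of the same measure, and uniqueness of densities gives the claim without any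
subtraction of integrals.\<close>

lemma AE_density_mono:
  assumes M: "sigma_finite_measure M"
    and [measurable]: "f \<in> borel_measurable M" "g \<in> borel_measurable M"
    and le: "\<And>A. A \<in> sets M \<Longrightarrow> emeasure (density M f) A \<le> emeasure (density M g) A"
  shows "AE x in M. f x \<le> (g x :: ennreal)"
proof -
  interpret sigma_finite_measure M by fact
  have "density M f = density M (\<lambda>x. min (f x) (g x))"
  proof (rule measure_eqI)
    fix A assume "A \<in> sets (density M f)"
    then have A[measurable]: "A \<in> sets M" by simp
    define B where "B = {x \<in> space M. f x \<le> g x}"
    have B[measurable]: "B \<in> sets M" unfolding B_def by measurable
    have "emeasure (density M f) A = emeasure (density M f) (A \<inter> B) + emeasure (density M f) (A - B)"
      by (subst plus_emeasure) (auto intro!: arg_cong2[where f=emeasure])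
    also have "emeasure (density M f) (A \<inter> B) = emeasure (density M (\<lambda>x. min (f x) (g x))) (A \<inter> B)"
      by (auto simp: emeasure_density B_def split: split_indicator intro!: nn_integral_cong)
    also have "emeasure (density M f) (A - B) \<le> emeasure (density M g) (A - B)"
      by (rule le) simp
    also have "emeasure (density M g) (A - B) = emeasure (density M (\<lambda>x. min (f x) (g x))) (A - B)"
      by (auto simp: emeasure_density B_def split: split_indicator intro!: nn_integral_cong)
    also have "emeasure (density M (\<lambda>x. min (f x) (g x))) (A \<inter> B) + emeasure (density M (\<lambda>x. min (f x) (g x))) (A - B)
       = emeasure (density M (\<lambda>x. min (f x) (g x))) A"
      by (subst plus_emeasure) (auto intro!: arg_cong2[where f=emeasure])
    finally have "emeasure (density M f) A \<le> emeasure (density M (\<lambda>x. min (f x) (g x))) A"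
      by (auto simp: add_left_mono)
    moreover have "emeasure (density M (\<lambda>x. min (f x) (g x))) A \<le> emeasure (density M f) A"
      by (auto simp: emeasure_density split: split_indicator intro!: nn_integral_mono)
    ultimately show "emeasure (density M f) A = emeasure (density M (\<lambda>x. min (f x) (g x))) A"
      by simp
  qed simp
  then have "AE x in M. f x = min (f x) (g x)"
    by (subst (asm) density_unique_iff) auto
  then show ?thesis by eventually_elim (metis min.cobounded2)
qed

text \<open>The rays \<open>{..<t}\<close> generate the Borel sets but need not cover a linear order with a greatest element,
such as \<^typ>\<open>ereal\<close>; the whole line is added to the generator for that reason.\<close>

lemma pair_measure_eqI_lessThan:
  fixes P Q :: "('y \<times> 'l :: {second_countable_topology, linorder_topology}) measure"
  assumes P: "prob_space P" "sets P = sets (N \<Otimes>\<^sub>M borel)"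
    and Q: "sets Q = sets (N \<Otimes>\<^sub>M borel)"
    and full: "\<And>B. B \<in> sets N \<Longrightarrow> emeasure P (B \<times> UNIV) = emeasure Q (B \<times> UNIV)"
    and less: "\<And>B t. B \<in> sets N \<Longrightarrow> emeasure P (B \<times> {..<t}) = emeasure Q (B \<times> {..<t})"
  shows "P = Q"
proof -
  interpret prob_space P by fact
  define C where "C = insert UNIV (range lessThan :: 'l set set)"
  define E where "E = {B \<times> c | B c. B \<in> sets N \<and> c \<in> C}"
  have "sets (borel :: 'l measure) = sigma_sets UNIV (range lessThan)"
    by (subst borel_Iio) simp
  also have "\<dots> = sigma_sets UNIV C"
    unfolding C_def by (rule sigma_sets_eqI) (auto intro: sigma_sets_top)
  finally have "sets (N \<Otimes>\<^sub>M borel) = sets (N \<Otimes>\<^sub>M sigma (UNIV :: 'l set) C)"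
    by (intro sets_pair_measure_cong) auto
  also have "\<dots> = sets (sigma (space N \<times> space (sigma (UNIV :: 'l set) C)) E)"
    unfolding E_def
    by (rule sets_pair_eq[where Ca = "{space N}" and Cb = "{UNIV}"])
       (auto simp: C_def sets.space_closed sets.sigma_sets_eq)
  also have "\<dots> = sets (sigma (space N \<times> UNIV) E)"
    by simp
  also have "\<dots> = sigma_sets (space N \<times> UNIV) E"
    by (rule sets_measure_of) (use sets.sets_into_space in \<open>fastforce simp: E_def\<close>)
  finally have sets: "sets (N \<Otimes>\<^sub>M borel) = sigma_sets (space N \<times> (UNIV :: 'l set)) E" .
  have C_Int: "c \<inter> d \<in> C" if "c \<in> C" "d \<in> C" for c d
    using that by (auto simp: C_def greaterThan_Int_greaterThan)
  show ?thesis
  proof (rule measure_eqI_generator_eq[where E = E and A = "\<lambda>_. space N \<times> UNIV" and \<Omega> = "space N \<times> UNIV"])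
    show "Int_stable E"
    proof (rule Int_stableI)
      fix X Y assume "X \<in> E" "Y \<in> E"
      then obtain B c B' c' where "X = B \<times> c" "Y = B' \<times> c'"
        and *: "B \<in> sets N" "B' \<in> sets N" "c \<in> C" "c' \<in> C"
        by (auto simp: E_def)
      then have "X \<inter> Y = (B \<inter> B') \<times> (c \<inter> c')" by auto
      moreover have "B \<inter> B' \<in> sets N" "c \<inter> c' \<in> C" using * by (auto intro: C_Int)
      ultimately show "X \<inter> Y \<in> E" unfolding E_def by blast
    qed
    show "E \<subseteq> Pow (space N \<times> UNIV)"
      using sets.sets_into_space[of _ N] by (auto simp: E_def)
    show "range (\<lambda>_. space N \<times> UNIV) \<subseteq> E"
      by (auto simp: E_def C_def)
    show "emeasure P X = emeasure Q X" if "X \<in> E" for X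
      using that by (auto simp: E_def C_def full less)
  qed (use P Q sets in auto)
qed


text \<open>A countable union of a chain is the limit of the sequence obtained from running maxima of an
enumeration, so continuity from below transfers the equality of measures from the members of the two
chains to their unions, even between different spaces.\<close>

lemma emeasure_UN_mono_cong:
  fixes S :: "'i :: linorder \<Rightarrow> 'a set" and S' :: "'i \<Rightarrow> 'b set"
  assumes R: "countable R" and mono: "mono S" "mono S'"
    and [measurable]: "\<And>q. S q \<in> sets M" "\<And>q. S' q \<in> sets M'"
    and eq: "\<And>q. emeasure M (S q) = emeasure M' (S' q)"
  shows "emeasure M (\<Union>q\<in>R. S q) = emeasure M' (\<Union>q\<in>R. S' q)"
proof (cases "R = {}")
  case False
  define m where "m n = Max (from_nat_into R ` {..n})" for n :: nat
  have m_mono: "mono m"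
    unfolding m_def by (intro monoI Max_mono) auto
  have m_in: "m n \<in> R" for n
  proof -
    have "m n \<in> from_nat_into R ` {..n}" unfolding m_def by (intro Max_in) auto
    then show ?thesis using from_nat_into[OF False] by auto
  qed
  have m_cofinal: "\<exists>n. q \<le> m n" if "q \<in> R" for q
  proof -
    obtain n where "from_nat_into R n = q"
      using from_nat_into_surj[OF R \<open>q \<in> R\<close>] by blast
    then show ?thesis unfolding m_def by (intro exI[of _ n] Max_ge) auto
  qed
  have UN: "(\<Union>q\<in>R. F q) = (\<Union>n. F (m n))" if "mono F" for F :: "'i \<Rightarrow> 'c set"
    using m_in m_cofinal monoD[OF that] by fast
  have "emeasure M (\<Union>n. S (m n)) = (SUP n. emeasure M (S (m n)))"
    by (rule SUP_emeasure_incseq[symmetric])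
       (auto intro: monoI monoD[OF m_mono] monoD[OF mono(1), THEN subsetD])
  also have "\<dots> = (SUP n. emeasure M' (S' (m n)))"
    by (simp add: eq)
  also have "\<dots> = emeasure M' (\<Union>n. S' (m n))"
    by (rule SUP_emeasure_incseq)
       (auto intro: monoI monoD[OF m_mono] monoD[OF mono(2), THEN subsetD])
  finally show ?thesis by (simp add: UN mono)
qed simp

section \<open>Conditional quantiles\<close>

text \<open>A conditional distribution function of the second component given the first, at rational points only.
Each \<open>f q\<close> comes from a Radon-Nikodym derivative, which is determined only almost everywhere; since
there are countably many rationals, a single null set carries all failures of monotonicity and of the
bound by 1, and \<open>f\<close> is set to 0 there. Neither right-continuity nor the limits at infinity are
arranged: they are recovered from the identity of measures in which \<open>f\<close> is used.\<close>

lemma conditional_cdf: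
  fixes Q :: "('y \<times> real) measure"
  assumes Q: "prob_space Q" and sets_Q[measurable_cong]: "sets Q = sets (N \<Otimes>\<^sub>M borel)"
  obtains f :: "rat \<Rightarrow> 'y \<Rightarrow> ennreal"
  where "\<And>q. f q \<in> borel_measurable N"
    and "\<And>q r y. q \<le> r \<Longrightarrow> f q y \<le> f r y" and "\<And>q y. f q y \<le> 1"
    and "\<And>B q. B \<in> sets N \<Longrightarrow>
      (\<integral>\<^sup>+y\<in>B. f q y \<partial>distr Q N fst) = emeasure Q (B \<times> {..<of_rat q})"
proof -
  interpret Q: prob_space Q by fact
  define \<nu> where "\<nu> = distr Q N fst"
  interpret \<nu>: prob_space \<nu>
    unfolding \<nu>_def by (rule Q.prob_space_distr) measurable
  have sets_\<nu>[measurable_cong]: "sets \<nu> = sets N" by (simp add: \<nu>_def)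
  have space_Q: "space Q = space N \<times> UNIV"
    using sets_eq_imp_space_eq[OF sets_Q] by (simp add: space_pair_measure)
  \<comment> \<open>The part of \<open>\<nu>\<close> that comes from second components below \<open>q\<close>; its density with respect to \<open>\<nu>\<close>
    is the conditional probability of that event.\<close>
  define \<kappa> where
    "\<kappa> q = distr (density Q (\<lambda>z. indicator {..<of_rat q :: real} (snd z))) N fst" for q :: rat
  have sets_\<kappa>: "sets (\<kappa> q) = sets \<nu>" for q by (simp add: \<kappa>_def sets_\<nu>)
  have \<kappa>: "emeasure (\<kappa> q) B = emeasure Q (B \<times> {..<of_rat q})" if [measurable]: "B \<in> sets N" for B q
  proof -
    have B: "B \<subseteq> space N" by (rule sets.sets_into_space) fact
    have "emeasure (\<kappa> q) B = (\<integral>\<^sup>+z. indicator {..<of_rat q} (snd z) *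
        indicator (fst -` B \<inter> space Q) z \<partial>Q)"
      unfolding \<kappa>_def by (simp add: emeasure_distr emeasure_density)
    also have "\<dots> = (\<integral>\<^sup>+z. indicator (B \<times> {..<of_rat q}) z \<partial>Q)"
      using B by (intro nn_integral_cong) (auto simp: space_Q split: split_indicator)
    also have "\<dots> = emeasure Q (B \<times> {..<of_rat q})" by simp
    finally show ?thesis .
  qed
  have \<nu>: "emeasure \<nu> B = emeasure Q (B \<times> UNIV)" if [measurable]: "B \<in> sets N" for B
  proof -
    have "fst -` B \<inter> space Q = B \<times> UNIV"
      using sets.sets_into_space[OF that] by (auto simp: space_Q)
    then show ?thesis by (simp add: \<nu>_def emeasure_distr)
  qed
  have \<kappa>_le: "emeasure (\<kappa> q) B \<le> emeasure \<nu> B" if [measurable]: "B \<in> sets N" for B q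
    unfolding \<kappa>[OF that] \<nu>[OF that] by (intro emeasure_mono) auto
  have "\<exists>g \<in> borel_measurable \<nu>. density \<nu> g = \<kappa> q" for q
  proof (rule \<nu>.Radon_Nikodym)
    show "absolutely_continuous \<nu> (\<kappa> q)"
      using \<kappa>_le[of _ q] by (auto simp: absolutely_continuous_def null_sets_def sets_\<kappa> sets_\<nu>)
         (metis le_zero_eq)
  qed (rule sets_\<kappa>)
  then obtain g where g[measurable]: "\<And>q. g q \<in> borel_measurable \<nu>"
    and dens: "\<And>q. density \<nu> (g q) = \<kappa> q"
    by metis
  define good where "good y \<longleftrightarrow> (\<forall>q. (\<forall>r. q \<le> r \<longrightarrow> g q y \<le> g r y) \<and> g q y \<le> 1)" for y
  have [measurable]: "Measurable.pred N good"
    unfolding good_def by measurable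
  have AE_good: "AE y in \<nu>. good y"
    unfolding good_def AE_all_countable AE_conj_iff
  proof (intro allI conjI)
    fix q r :: rat
    show "AE y in \<nu>. q \<le> r \<longrightarrow> g q y \<le> g r y"
    proof (cases "q \<le> r")
      case True
      have "emeasure (\<kappa> q) B \<le> emeasure (\<kappa> r) B" if [measurable]: "B \<in> sets N" for B
        unfolding \<kappa>[OF that] using True 
        by (intro emeasure_mono) (auto intro: less_le_trans simp: of_rat_less_eq)
      then have "AE y in \<nu>. g q y \<le> g r y"
        by (intro AE_density_mono \<nu>.sigma_finite_measure_axioms g) (auto simp: dens sets_\<nu>)
      then show ?thesis by auto
    qed simp
  next
    fix q
    have "density \<nu> (\<lambda>_. 1) = \<nu>" by (rule density_1)
    then show "AE y in \<nu>. g q y \<le> 1"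
      by (intro AE_density_mono \<nu>.sigma_finite_measure_axioms g) (auto simp: dens sets_\<nu> \<kappa>_le)
  qed
  show thesis
  proof (rule that[of "\<lambda>q y. if good y then g q y else 0"])
    fix B q assume B[measurable]: "B \<in> sets N"
    have "(\<integral>\<^sup>+y\<in>B. (if good y then g q y else 0) \<partial>\<nu>) = (\<integral>\<^sup>+y\<in>B. g q y \<partial>\<nu>)"
      using AE_good by (intro nn_integral_cong_AE) auto
    also have "\<dots> = emeasure (density \<nu> (g q)) B"
      by (simp add: emeasure_density)
    finally show "(\<integral>\<^sup>+y\<in>B. (if good y then g q y else 0) \<partial>distr Q N fst)
        = emeasure Q (B \<times> {..<of_rat q})"
      by (simp only: dens \<kappa>[OF B] \<nu>_def[symmetric])
  qed (auto simp: good_def[symmetric], auto simp: good_def)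
qed

definition noise :: "real measure" where
  "noise = uniform_measure lborel {0..1}"

lemma prob_space_noise: "prob_space noise"
  unfolding noise_def by (rule prob_space_uniform_measure) auto

lemma sets_noise[measurable_cong]: "sets noise = sets borel"
  by (simp add: noise_def)

lemma emeasure_noise_less:
  assumes "c \<le> 1"
  shows "emeasure noise {u. ennreal u < c} = c"
proof -
  obtain r where r: "c = ennreal r" "0 \<le> r" "r \<le> 1"
    using assms by (cases c) (auto simp: top_unique)
  have "{0..1} \<inter> {u. ennreal u < c} = {0..<r}"
    using r by (auto simp: ennreal_less_iff)
  then show ?thesis
    unfolding noise_def by (subst emeasure_uniform_measure) (auto simp: r divide_ennreal_def)
qed

text \<open>The quantile transform, done conditionally: with \<open>f\<close> the conditional distribution function,
\<open>T(y, u)\<close> is the infimum of the rationals \<open>q\<close> with \<open>u < f q y\<close>. Then \<open>T(y, u) < t\<close> holds exactly when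
\<open>u < f q y\<close> for some rational \<open>q < t\<close>, so the law of \<open>(y, T(y, u))\<close> has the right value on
every rectangle \<open>B \<times> {..<t}\<close>. The pair \<open>(y, r)\<close> is thus reproduced from \<open>y\<close> and an independent
uniform variable, which replaces a regular conditional probability.\<close>

lemma noise_outsourcing:
  fixes Q :: "('y \<times> real) measure"
  assumes Q: "prob_space Q" and sets_Q[measurable_cong]: "sets Q = sets (N \<Otimes>\<^sub>M borel)"
  obtains T where "T \<in> borel_measurable (N \<Otimes>\<^sub>M borel)"
    and "distr (distr Q N fst \<Otimes>\<^sub>M noise) (N \<Otimes>\<^sub>M borel) (\<lambda>(y, u). (y, T (y, u))) = Q"
proof -
  interpret Q: prob_space Q by fact
  define \<nu> where "\<nu> = distr Q N fst"
  interpret \<nu>: prob_space \<nu>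
    unfolding \<nu>_def by (rule Q.prob_space_distr) measurable
  interpret noise: prob_space noise by (rule prob_space_noise)
  interpret \<nu>noise: prob_space "\<nu> \<Otimes>\<^sub>M noise"
    by (rule prob_space_pair) unfold_locales
  have sets_\<nu>[measurable_cong]: "sets \<nu> = sets N" by (simp add: \<nu>_def)
  have space_\<nu>: "space \<nu> = space N" by (simp add: \<nu>_def)
  have space_noise: "space noise = UNIV" by (simp add: noise_def)
  have space_Q: "space Q = space N \<times> UNIV"
    using sets_eq_imp_space_eq[OF sets_Q] by (simp add: space_pair_measure)
  obtain f :: "rat \<Rightarrow> 'y \<Rightarrow> ennreal"
    where f[measurable]: "\<And>q. f q \<in> borel_measurable N"
    and f_mono: "\<And>q r y. q \<le> r \<Longrightarrow> f q y \<le> f r y" and f_le1: "\<And>q y. f q y \<le> 1"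
    and f: "\<And>B q. B \<in> sets N \<Longrightarrow> (\<integral>\<^sup>+y\<in>B. f q y \<partial>\<nu>) = emeasure Q (B \<times> {..<of_rat q})"
    by (rule conditional_cdf[OF Q sets_Q, folded \<nu>_def]) (rule that)
  \<comment> \<open>The infimum is taken in the extended reals, where it exists even for the exceptional \<open>y\<close> and \<open>u\<close>.\<close>
  define T where "T = (\<lambda>(y, u). INF q. if ennreal u < f q y then ereal (of_rat q) else \<infinity>)"
  have T[measurable]: "T \<in> borel_measurable (N \<Otimes>\<^sub>M borel)"
    unfolding T_def by measurable
  have T_less: "T (y, u) < t \<longleftrightarrow> (\<exists>q\<in>{q. ereal (of_rat q) < t}. ennreal u < f q y)" for y u t
    unfolding T_def prod.case INF_less_iff by (auto split: if_splits)
  have less: "ereal r < t \<longleftrightarrow> (\<exists>q\<in>{q. ereal (of_rat q) < t}. r < of_rat q)" for r t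
  proof
    assume "ereal r < t"
    then obtain s where s: "ereal r < ereal s" "ereal s < t"
      using ereal_dense2 by blast
    then obtain q where "r < of_rat q" "of_rat q < s"
      using of_rat_dense by auto
    with s show "\<exists>q\<in>{q. ereal (of_rat q) < t}. r < of_rat q"
      by (auto intro!: exI[of _ q] intro: less_trans[of _ "ereal s"])
  next
    assume "\<exists>q\<in>{q. ereal (of_rat q) < t}. r < of_rat q"
    then obtain q where "ereal r < ereal (of_rat q)" "ereal (of_rat q) < t"
      by auto
    then show "ereal r < t" by (rule less_trans)
  qed
  define S where "S B q = {(y, u). y \<in> B \<and> ennreal u < f q y}" for B q
  have S_sets: "S B q \<in> sets (\<nu> \<Otimes>\<^sub>M noise)" if B[measurable]: "B \<in> sets N" for B q
  proof -
    have "S B q = {z \<in> space (\<nu> \<Otimes>\<^sub>M noise). fst z \<in> B \<and> ennreal (snd z) < f q (fst z)}"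
      using sets.sets_into_space[OF B] by (auto simp: S_def space_pair_measure space_\<nu> space_noise)
    also have "\<dots> \<in> sets (\<nu> \<Otimes>\<^sub>M noise)" by measurable
    finally show ?thesis .
  qed
  have S_mono: "mono (S B)" for B
    by (rule monoI) (auto simp: S_def intro: less_le_trans[OF _ f_mono])
  have S_measure: "emeasure (\<nu> \<Otimes>\<^sub>M noise) (S B q) = emeasure Q (B \<times> {..<of_rat q})"
    if B: "B \<in> sets N" for B q
  proof -
    have "emeasure (\<nu> \<Otimes>\<^sub>M noise) (S B q) = (\<integral>\<^sup>+y. emeasure noise (Pair y -` S B q) \<partial>\<nu>)"
      by (rule noise.emeasure_pair_measure_alt[OF S_sets[OF B]])
    also have "\<dots> = (\<integral>\<^sup>+y\<in>B. f q y \<partial>\<nu>)"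
      by (intro nn_integral_cong) (auto simp: S_def emeasure_noise_less f_le1 split: split_indicator)
    finally show ?thesis by (simp add: f[OF B])
  qed
  have "distr (\<nu> \<Otimes>\<^sub>M noise) (N \<Otimes>\<^sub>M borel) (\<lambda>(y, u). (y, T (y, u)))
      = distr Q (N \<Otimes>\<^sub>M borel) (\<lambda>(y, r). (y, ereal r))" (is "?L = ?R")
  proof (rule pair_measure_eqI_lessThan)
    show "prob_space ?L" by (rule \<nu>noise.prob_space_distr) measurable
    fix B assume B[measurable]: "B \<in> sets N"
    have "emeasure ?L (B \<times> UNIV) = emeasure (\<nu> \<Otimes>\<^sub>M noise) (B \<times> space noise)"
      using sets.sets_into_space[OF B]
      by (auto simp: emeasure_distr space_pair_measure space_\<nu> space_noise intro!: arg_cong2[where f=emeasure])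
    also have "\<dots> = emeasure \<nu> B"
      by (simp add: noise.emeasure_pair_measure_Times noise.emeasure_space_1)
    also have "\<dots> = emeasure ?R (B \<times> UNIV)"
      using sets.sets_into_space[OF B]
      by (auto simp: \<nu>_def emeasure_distr space_Q intro!: arg_cong2[where f=emeasure])
    finally show "emeasure ?L (B \<times> UNIV) = emeasure ?R (B \<times> UNIV)" .
    fix t
    let ?I = "{q. ereal (of_rat q) < t}"
    have "emeasure ?L (B \<times> {..<t}) = emeasure (\<nu> \<Otimes>\<^sub>M noise) (\<Union>q\<in>?I. S B q)"
      using sets.sets_into_space[OF B]
      by (auto simp: S_def emeasure_distr space_pair_measure space_\<nu> space_noise T_less
          intro!: arg_cong2[where f=emeasure])
    also have "\<dots> = emeasure Q (\<Union>q\<in>?I. B \<times> {..<of_rat q})"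
    proof (rule emeasure_UN_mono_cong)
      show "mono (\<lambda>q. B \<times> {..<of_rat q :: real})"
        by (rule monoI) (intro Sigma_mono subset_refl, simp add: of_rat_less_eq)
    qed (simp_all add: S_mono S_sets[OF B] S_measure[OF B])
    also have "(\<Union>q\<in>?I. B \<times> {..<of_rat q}) = B \<times> {r. ereal r < t}"
      using less[of _ t] by blast
    also have "emeasure Q \<dots> = emeasure ?R (B \<times> {..<t})"
      using sets.sets_into_space[OF B]
      by (auto simp: emeasure_distr space_Q intro!: arg_cong2[where f=emeasure])
    finally show "emeasure ?L (B \<times> {..<t}) = emeasure ?R (B \<times> {..<t})" .
  qed auto
  \<comment> \<open>The right-hand law lives on finite values, so \<open>T\<close> is finite almost surely and
    \<^const>\<open>real_of_ereal\<close> turns it into a real variable with the same law.\<close>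
  then have "distr ?L (N \<Otimes>\<^sub>M borel) (\<lambda>(y, t). (y, real_of_ereal t))
      = distr ?R (N \<Otimes>\<^sub>M borel) (\<lambda>(y, t). (y, real_of_ereal t))"
    by simp
  also have "distr ?R (N \<Otimes>\<^sub>M borel) (\<lambda>(y, t). (y, real_of_ereal t)) = Q"
    by (subst distr_distr) (auto simp: comp_def case_prod_beta sets_Q intro!: distr_id2)
  finally have "distr (\<nu> \<Otimes>\<^sub>M noise) (N \<Otimes>\<^sub>M borel) (\<lambda>(y, u). (y, real_of_ereal (T (y, u)))) = Q"
    by (simp add: distr_distr comp_def split_def)
  then have law: "distr (distr Q N fst \<Otimes>\<^sub>M noise) (N \<Otimes>\<^sub>M borel)
      (\<lambda>(y, u). (y, real_of_ereal (T (y, u)))) = Q"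
    unfolding \<nu>_def .
  have "(\<lambda>z. real_of_ereal (T z)) \<in> borel_measurable (N \<Otimes>\<^sub>M borel)"
    by measurable
  then show thesis by (rule that[OF _ law])
qed

section \<open>Gluing couplings\<close>

text \<open>Apply \<open>T\<close> from noise outsourcing to \<open>p a\<close> instead of \<open>y\<close>: under the joint law of \<open>(a, u)\<close> the pair
\<open>(p a, u)\<close> has the law for which \<open>T\<close> was built, because \<open>p\<close> carries \<open>P\<close> to the first marginal of \<open>Q\<close>.\<close>

lemma gluing_real:
  fixes Q :: "('y \<times> real) measure"
  assumes P: "prob_space P" and p[measurable]: "p \<in> P \<rightarrow>\<^sub>M N"
    and Q: "prob_space Q" and sets_Q[measurable_cong]: "sets Q = sets (N \<Otimes>\<^sub>M borel)"
    and eq: "distr P N p = distr Q N fst"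
  obtains h where "h \<in> borel_measurable (P \<Otimes>\<^sub>M noise)"
    and "distr (P \<Otimes>\<^sub>M noise) (N \<Otimes>\<^sub>M borel) (\<lambda>(a, u). (p a, h (a, u))) = Q"
proof -
  interpret noise: prob_space noise by (rule prob_space_noise)
  obtain T where T[measurable]: "T \<in> borel_measurable (N \<Otimes>\<^sub>M borel)"
    and law: "distr (distr Q N fst \<Otimes>\<^sub>M noise) (N \<Otimes>\<^sub>M borel) (\<lambda>(y, u). (y, T (y, u))) = Q"
    by (rule noise_outsourcing[OF Q sets_Q])
  have noise_id: "distr noise noise id = noise"
    by (simp add: id_def)
  have "distr P N p \<Otimes>\<^sub>M distr noise noise id = distr (P \<Otimes>\<^sub>M noise) (N \<Otimes>\<^sub>M noise) (\<lambda>(a, u). (p a, id u))"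
    by (intro pair_measure_distr p) (auto simp: noise_id intro: noise.sigma_finite_measure_axioms)
  then have "distr Q N fst \<Otimes>\<^sub>M noise = distr (P \<Otimes>\<^sub>M noise) (N \<Otimes>\<^sub>M noise) (\<lambda>(a, u). (p a, u))"
    by (simp add: noise_id eq)
  then have "Q = distr (P \<Otimes>\<^sub>M noise) (N \<Otimes>\<^sub>M borel) (\<lambda>(a, u). (p a, T (p a, u)))"
    using law by (simp add: distr_distr comp_def split_def)
  then show thesis
    by (intro that[of "\<lambda>(a, u). T (p a, u)"]) (auto simp: split_def)
qed

text \<open>The coordinates of \<open>z\<close> are attached to \<open>a\<close> one at a time. At a stage where the coordinates in \<open>S\<close> are
present, the space that has been built maps to \<open>(p a, z\<^sub>S)\<close>, with the law that \<open>Q\<close> prescribes;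
the next coordinate is a real random variable, and gluing it along \<open>(y, z\<^sub>S)\<close>
is the one-dimensional case.\<close>

lemma gluing:
  fixes Q :: "('y \<times> 'z :: euclidean_space) measure"
  assumes P: "prob_space P" and p[measurable]: "p \<in> P \<rightarrow>\<^sub>M N"
    and Q: "prob_space Q" and sets_Q[measurable_cong]: "sets Q = sets (N \<Otimes>\<^sub>M borel)"
    and eq: "distr P N p = distr Q N fst"
  obtains R where "prob_space R" "sets R = sets (P \<Otimes>\<^sub>M (borel :: 'z measure))" "distr R P fst = P"
    "distr R (N \<Otimes>\<^sub>M borel) (\<lambda>(a, z). (p a, z)) = Q"
proof -
  interpret P: prob_space P by fact
  interpret Q: prob_space Q by fact
  interpret noise: prob_space noise by (rule prob_space_noise)
  \<comment> \<open>Forgetting the coordinates outside \<open>S\<close> without changing the type.\<close>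
  define proj where "proj S z = (\<Sum>b\<in>S. (z \<bullet> b) *\<^sub>R b)" for S and z :: 'z
  have [measurable]: "proj S \<in> borel \<rightarrow>\<^sub>M borel" for S
    unfolding proj_def by measurable
  have "\<exists>R. prob_space R \<and> sets R = sets (P \<Otimes>\<^sub>M (borel :: 'z measure)) \<and> distr R P fst = P \<and>
      distr R (N \<Otimes>\<^sub>M borel) (\<lambda>(a, z). (p a, z)) = distr Q (N \<Otimes>\<^sub>M borel) (\<lambda>(y, z). (y, proj S z))"
    if "finite S" for S
    using that
  proof induction
    case empty
    let ?R = "distr P (P \<Otimes>\<^sub>M borel) (\<lambda>a. (a, 0 :: 'z))"
    have "distr ?R (N \<Otimes>\<^sub>M borel) (\<lambda>(a, z). (p a, z)) =
        distr (distr P N p) (N \<Otimes>\<^sub>M borel) (\<lambda>y. (y, 0))"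
      by (simp add: distr_distr comp_def)
    also have "\<dots> = distr Q (N \<Otimes>\<^sub>M borel) (\<lambda>(y, z). (y, proj {} z))"
      unfolding eq by (simp add: distr_distr comp_def split_def proj_def)
    finally show ?case
      by (intro exI[of _ ?R]) (auto simp: distr_distr comp_def intro!: P.prob_space_distr)
  next
    case (insert b S)
    then obtain R where R: "prob_space R"
      and sets_R[measurable_cong]: "sets R = sets (P \<Otimes>\<^sub>M (borel :: 'z measure))"
      and R_fst: "distr R P fst = P"
      and R_law: "distr R (N \<Otimes>\<^sub>M borel) (\<lambda>(a, z). (p a, z)) =
        distr Q (N \<Otimes>\<^sub>M borel) (\<lambda>(y, z). (y, proj S z))"
      by blast
    interpret R: prob_space R by (rule R)
    interpret R_noise: prob_space "R \<Otimes>\<^sub>M noise"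
      by (rule prob_space_pair) unfold_locales
    define Q' where
      "Q' = distr Q ((N \<Otimes>\<^sub>M borel) \<Otimes>\<^sub>M borel) (\<lambda>(y, z). ((y, proj S z), z \<bullet> b))"
    obtain h where h[measurable]: "h \<in> borel_measurable (R \<Otimes>\<^sub>M noise)"
      and law: "distr (R \<Otimes>\<^sub>M noise) ((N \<Otimes>\<^sub>M borel) \<Otimes>\<^sub>M borel)
          (\<lambda>(w, u). ((\<lambda>(a, z). (p a, z)) w, h (w, u))) = Q'"
    proof (rule gluing_real[OF R])
      show "(\<lambda>(a, z). (p a, z)) \<in> R \<rightarrow>\<^sub>M N \<Otimes>\<^sub>M borel" by measurable
      show "prob_space Q'" unfolding Q'_def by (rule Q.prob_space_distr) measurable
      show "distr R (N \<Otimes>\<^sub>M borel) (\<lambda>(a, z). (p a, z)) = distr Q' (N \<Otimes>\<^sub>M borel) fst"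
        unfolding R_law Q'_def by (simp add: distr_distr comp_def split_def)
    qed (auto simp: Q'_def)
    let ?R' = "distr (R \<Otimes>\<^sub>M noise) (P \<Otimes>\<^sub>M borel) (\<lambda>(w, u). (fst w, snd w + h (w, u) *\<^sub>R b))"
    have "distr ?R' P fst = distr (distr (R \<Otimes>\<^sub>M noise) R fst) P fst"
      by (simp add: distr_distr comp_def split_def)
    then have fst: "distr ?R' P fst = P"
      by (simp add: noise.distr_pair_fst R_fst)
    have "distr ?R' (N \<Otimes>\<^sub>M borel) (\<lambda>(a, z). (p a, z)) =
        distr Q' (N \<Otimes>\<^sub>M borel) (\<lambda>((y, z), r). (y, z + r *\<^sub>R b))"
      unfolding law[symmetric] by (simp add: distr_distr comp_def split_def)
    also have "\<dots> = distr Q (N \<Otimes>\<^sub>M borel) (\<lambda>(y, z). (y, proj S z + (z \<bullet> b) *\<^sub>R b))"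
      unfolding Q'_def by (simp add: distr_distr comp_def split_def)
    also have "\<dots> = distr Q (N \<Otimes>\<^sub>M borel) (\<lambda>(y, z). (y, proj (insert b S) z))"
      using insert by (simp add: proj_def add.commute)
    finally show ?case
      using fst by (intro exI[of _ ?R']) (auto intro!: R_noise.prob_space_distr)
  qed
  from this[OF finite_Basis] obtain R where R: "prob_space R"
      "sets R = sets (P \<Otimes>\<^sub>M (borel :: 'z measure))" "distr R P fst = P"
      "distr R (N \<Otimes>\<^sub>M borel) (\<lambda>(a, z). (p a, z)) = distr Q (N \<Otimes>\<^sub>M borel) (\<lambda>(y, z). (y, proj Basis z))"
    by blast
  have "distr Q (N \<Otimes>\<^sub>M borel) (\<lambda>(y, z). (y, proj Basis z)) = Q"
    by (simp add: proj_def euclidean_representation sets_Q distr_id2 id_def)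
  with R show thesis by (intro that) simp_all
qed

lemma gluings_nonempty:
  fixes \<mu> \<nu> \<eta> :: "(real ^ 'n) measure"
  assumes \<gamma>12: "\<gamma>12 \<in> couplings \<mu> \<nu>" and \<gamma>23: "\<gamma>23 \<in> couplings \<nu> \<eta>"
  shows "\<exists>\<pi>. \<pi> \<in> gluings \<gamma>12 \<gamma>23"
proof -
  have prob: "prob_space \<gamma>12" "prob_space \<gamma>23"
    and sets[measurable_cong]: "sets \<gamma>12 = sets (borel \<Otimes>\<^sub>M borel)" "sets \<gamma>23 = sets (borel \<Otimes>\<^sub>M borel)"
    and marginal: "distr \<gamma>12 borel snd = distr \<gamma>23 borel fst"
    using assms unfolding couplings_def borel_probs_def borel_prod by auto
  obtain R where R: "prob_space R"
    and sets_R[measurable_cong]: "sets R = sets (\<gamma>12 \<Otimes>\<^sub>M (borel :: (real ^ 'n) measure))"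
    and R12: "distr R \<gamma>12 fst = \<gamma>12"
    and R23: "distr R (borel \<Otimes>\<^sub>M borel) (\<lambda>(w, z). (snd w, z)) = \<gamma>23"
    by (rule gluing[OF prob(1) _ prob(2) sets(2) marginal]) auto
  interpret R: prob_space R by (rule R)
  define \<pi> where "\<pi> = distr R (borel \<Otimes>\<^sub>M (borel \<Otimes>\<^sub>M borel)) (\<lambda>w. (fst (fst w), snd (fst w), snd w))"
  have "prob_space \<pi>"
    unfolding \<pi>_def by (rule R.prob_space_distr) measurable
  moreover have "sets \<pi> = sets borel"
    by (simp add: \<pi>_def borel_prod)
  moreover have "distr \<pi> (borel \<Otimes>\<^sub>M borel) (\<lambda>(x, y, z). (x, y)) = \<gamma>12"
  proof -
    have "distr \<pi> (borel \<Otimes>\<^sub>M borel) (\<lambda>(x, y, z). (x, y)) = distr R (borel \<Otimes>\<^sub>M borel) fst"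
      unfolding \<pi>_def by (simp add: distr_distr comp_def split_def)
    also have "\<dots> = distr R \<gamma>12 fst"
      by (rule distr_cong) (auto simp: sets)
    finally show ?thesis by (simp add: R12)
  qed
  moreover have "distr \<pi> (borel \<Otimes>\<^sub>M borel) (\<lambda>(x, y, z). (y, z)) = \<gamma>23"
    unfolding R23[symmetric] \<pi>_def by (simp add: distr_distr comp_def split_def)
  ultimately show ?thesis
    by (auto simp: gluings_def borel_probs_def borel_prod)
qed

section \<open>Frame bounds\<close>

text \<open>Evaluate the quadratic form of the matrix identity \<open>\<integral> a b\<^sup>T = Id\<close> at \<open>x\<close>.\<close>

lemma dual_frame_quadratic_form:
  fixes x :: "real ^ 'n"
  assumes "prob_dual_frame \<mu> \<nu> \<gamma>"
  shows "has_bochner_integral \<gamma> (\<lambda>(a, b). (x \<bullet> a) * (b \<bullet> x)) ((norm x)\<^sup>2)"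
proof -
  let ?T = "\<lambda>A :: real ^ 'n ^ 'n. x \<bullet> (A *v x)"
  have "linear ?T"
    by (rule linearI) (simp_all add: matrix_vector_mult_add_rdistrib inner_add_right
        scaleR_matrix_vector_assoc[symmetric])
  then have "bounded_linear ?T" by (rule linear_conv_bounded_linear[THEN iffD1])
  from has_bochner_integral_bounded_linear[OF this]
  have "has_bochner_integral \<gamma> (\<lambda>z. ?T ((\<lambda>(a, b).
      (columnvector a :: real ^ 1 ^ 'n) ** transpose (columnvector b)) z)) (?T (mat 1))"
    using assms unfolding prob_dual_frame_def by blast
  also have "?T (mat 1) = (norm x)\<^sup>2"
    by (simp add: power2_norm_eq_inner)
  also have "(\<lambda>z. ?T ((\<lambda>(a, b).
      (columnvector a :: real ^ 1 ^ 'n) ** transpose (columnvector b)) z)) =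
      (\<lambda>(a, b). (x \<bullet> a) * (b \<bullet> x))"
  proof -
    have "((columnvector a :: real ^ 1 ^ 'n) ** transpose (columnvector b)) *v x = (b \<bullet> x) *\<^sub>R a"
      for a b :: "real ^ 'n"
      by (simp add: vec_eq_iff matrix_vector_mult_def matrix_matrix_mult_def columnvector_def
          transpose_def inner_vec_def sum_distrib_left sum_distrib_right mult_ac)
    then show ?thesis by (auto simp: mult.commute)
  qed
  finally show ?thesis .
qed

lemma nn_integral_inner_sq_le_second_moment:
  assumes "\<mu> \<in> borel_probs2"
  shows "(\<integral>\<^sup>+ y. ennreal (\<bar>x \<bullet> y\<bar>\<^sup>2) \<partial>\<mu>) \<le> ennreal (enn2real (second_moment \<mu>) * (norm x)\<^sup>2)"
proof -
  have [measurable_cong]: "sets \<mu> = sets borel" and fin: "second_moment \<mu> < \<infinity>"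
    using assms by (auto simp: borel_probs2_def borel_probs_def)
  have "(\<integral>\<^sup>+ y. ennreal (\<bar>x \<bullet> y\<bar>\<^sup>2) \<partial>\<mu>) \<le> (\<integral>\<^sup>+ y. ennreal ((norm x)\<^sup>2) * ennreal ((norm y)\<^sup>2) \<partial>\<mu>)"
  proof (rule nn_integral_mono)
    fix y
    have "\<bar>x \<bullet> y\<bar>\<^sup>2 \<le> (norm x * norm y)\<^sup>2"
      by (intro power_mono Cauchy_Schwarz_ineq2) simp
    then show "ennreal (\<bar>x \<bullet> y\<bar>\<^sup>2) \<le> ennreal ((norm x)\<^sup>2) * ennreal ((norm y)\<^sup>2)"
      by (simp add: power_mult_distrib ennreal_mult[symmetric])
  qed
  also have "\<dots> = ennreal ((norm x)\<^sup>2) * second_moment \<mu>"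
    unfolding second_moment_def by (rule nn_integral_cmult) measurable
  also have "\<dots> = ennreal (enn2real (second_moment \<mu>) * (norm x)\<^sup>2)"
    using fin by (simp add: ennreal_mult'' mult.commute)
  finally show ?thesis .
qed

text \<open>Write \<open>\<parallel>x\<parallel>\<^sup>2\<close> as the integral of \<open>(x \<bullet> a) (b \<bullet> x)\<close> and replace \<open>a\<close> by \<open>c\<close>, the third component of
the gluing. The error is at most \<open>\<parallel>x\<parallel>\<^sup>2 \<parallel>b\<parallel> \<parallel>a - c\<parallel>\<close>, whose integral is \<open>s \<parallel>x\<parallel>\<^sup>2\<close>, and the
remaining integral of \<open>(x \<bullet> b) (x \<bullet> c)\<close> is at most \<open>sqrt (D \<parallel>x\<parallel>\<^sup>2 I)\<close>, where \<open>I\<close> is the integral to be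
bounded below. Instead of the Cauchy-Schwarz inequality for integrals, the proof
uses \<open>2 t u v \<le> t\<^sup>2 u\<^sup>2 + v\<^sup>2\<close> pointwise, with one constant \<open>t\<close>.\<close>

lemma frame_lower_bound:
  fixes x :: "real ^ 'n"
  assumes dual: "prob_dual_frame \<mu> \<nu> \<gamma>12"
    and \<eta>: "\<eta> \<in> borel_probs2"
    and \<gamma>23: "\<gamma>23 \<in> couplings \<nu> \<eta>"
    and \<pi>: "\<pi> \<in> gluings \<gamma>12 \<gamma>23"
    and \<sigma>: "(\<integral>\<^sup>+ (x, y, z). ennreal (norm y * norm (x - z)) \<partial>\<pi>) = ennreal s" "0 \<le> s" "s < 1"
    and D: "0 < D" "(\<integral>\<^sup>+ y. ennreal (\<bar>x \<bullet> y\<bar>\<^sup>2) \<partial>\<nu>) \<le> ennreal (D * (norm x)\<^sup>2)"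
  shows "ennreal ((1 - s)\<^sup>2 / D * (norm x)\<^sup>2) \<le> (\<integral>\<^sup>+ z. ennreal (\<bar>x \<bullet> z\<bar>\<^sup>2) \<partial>\<eta>)"
proof -
  have [measurable_cong]: "sets \<pi> = sets (borel \<Otimes>\<^sub>M (borel \<Otimes>\<^sub>M borel))"
    and g12: "distr \<pi> borel (\<lambda>w. (fst w, fst (snd w))) = \<gamma>12"
    and g23: "distr \<pi> borel snd = \<gamma>23"
    using \<pi> unfolding gluings_def borel_probs_def borel_prod by (simp_all add: split_def)
  have \<nu>_eq: "distr \<gamma>23 borel fst = \<nu>" and \<eta>_eq: "distr \<gamma>23 borel snd = \<eta>"
    using \<gamma>23 by (auto simp: couplings_def)
  have [measurable]: "(\<lambda>w. (fst w, fst (snd w))) \<in> \<pi> \<rightarrow>\<^sub>M borel" "snd \<in> \<pi> \<rightarrow>\<^sub>M borel"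
    unfolding borel_prod[symmetric] by measurable
  have [measurable]: "(fst :: (real ^ 'n) \<times> (real ^ 'n) \<Rightarrow> _) \<in> borel \<rightarrow>\<^sub>M borel"
      "(snd :: (real ^ 'n) \<times> (real ^ 'n) \<Rightarrow> _) \<in> borel \<rightarrow>\<^sub>M borel"
    unfolding borel_prod[symmetric] by measurable
  have \<nu>: "\<nu> = distr \<pi> borel (\<lambda>w. fst (snd w))"
    unfolding \<nu>_eq[symmetric] g23[symmetric] by (simp add: distr_distr comp_def)
  have \<eta>': "\<eta> = distr \<pi> borel (\<lambda>w. snd (snd w))"
    unfolding \<eta>_eq[symmetric] g23[symmetric] by (simp add: distr_distr comp_def)
  define N where "N = (norm x)\<^sup>2"
  define I where "I = (\<integral>w. (x \<bullet> snd (snd w))\<^sup>2 \<partial>\<pi>)"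
  \<comment> \<open>The choice that maximises \<open>2 t (1 - s) N - t\<^sup>2 D N\<close>, the lower bound for \<open>I\<close> obtained below.\<close>
  define t where "t = (1 - s) / D"
  have t: "0 < t" using \<sigma> D by (simp add: t_def)

  have "has_bochner_integral (distr \<pi> borel (\<lambda>w. (fst w, fst (snd w)))) (\<lambda>(a, b). (x \<bullet> a) * (b \<bullet> x)) N"
    unfolding g12 N_def by (rule dual_frame_quadratic_form[OF dual])
  then have "has_bochner_integral \<pi> (\<lambda>w. (x \<bullet> fst w) * (fst (snd w) \<bullet> x)) N"
    by (auto simp: has_bochner_integral_iff integrable_distr_eq integral_distr split_def)
  then have int_N: "integrable \<pi> (\<lambda>w. (x \<bullet> fst w) * (fst (snd w) \<bullet> x))"
    and N: "(\<integral>w. (x \<bullet> fst w) * (fst (snd w) \<bullet> x) \<partial>\<pi>) = N"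
    by (auto simp: has_bochner_integral_iff)

  have "(\<integral>\<^sup>+ w. ennreal ((x \<bullet> fst (snd w))\<^sup>2) \<partial>\<pi>) = (\<integral>\<^sup>+ y. ennreal (\<bar>x \<bullet> y\<bar>\<^sup>2) \<partial>\<nu>)"
    unfolding \<nu> by (subst nn_integral_distr) auto
  with D have le_DN: "(\<integral>\<^sup>+ w. ennreal ((x \<bullet> fst (snd w))\<^sup>2) \<partial>\<pi>) \<le> ennreal (D * N)"
    by (simp add: N_def)
  have int_DN: "integrable \<pi> (\<lambda>w. (x \<bullet> fst (snd w))\<^sup>2)"
    by (rule integrableI_nonneg)
       (auto intro: le_less_trans[OF le_DN])
  have DN: "(\<integral>w. (x \<bullet> fst (snd w))\<^sup>2 \<partial>\<pi>) \<le> D * N"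
    using le_DN D by (simp add: nn_integral_eq_integral[OF int_DN] N_def)

  have \<eta>_nn: "(\<integral>\<^sup>+ w. ennreal ((x \<bullet> snd (snd w))\<^sup>2) \<partial>\<pi>) = (\<integral>\<^sup>+ y. ennreal (\<bar>x \<bullet> y\<bar>\<^sup>2) \<partial>\<eta>)"
    unfolding \<eta>' by (subst nn_integral_distr) auto
  have int_I: "integrable \<pi> (\<lambda>w. (x \<bullet> snd (snd w))\<^sup>2)"
    using le_less_trans[OF nn_integral_inner_sq_le_second_moment[OF \<eta>, of x]]
    by (intro integrableI_nonneg) (auto simp: \<eta>_nn)
  have I: "(\<integral>\<^sup>+ y. ennreal (\<bar>x \<bullet> y\<bar>\<^sup>2) \<partial>\<eta>) = ennreal I"
    unfolding I_def \<eta>_nn[symmetric] by (rule nn_integral_eq_integral[OF int_I]) simp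

  let ?d = "\<lambda>w. norm (fst (snd w)) * norm (fst w - snd (snd w))"
  have d_nn: "(\<integral>\<^sup>+ w. ennreal (?d w) \<partial>\<pi>) = ennreal s"
    using \<sigma>(1) by (simp add: split_def)
  have int_s: "integrable \<pi> ?d"
    by (rule integrableI_nonneg) (auto simp: d_nn)
  have s: "(\<integral>w. ?d w \<partial>\<pi>) = s"
    using d_nn \<sigma> by (subst (asm) nn_integral_eq_integral[OF int_s]) (auto simp: integral_nonneg_AE)

  have pointwise: "2 * t * ((x \<bullet> a) * (b \<bullet> x)) \<le>
      t\<^sup>2 * (x \<bullet> b)\<^sup>2 + (x \<bullet> c)\<^sup>2 + 2 * t * N * (norm b * norm (a - c))" for a b c
  proof -
    have "(x \<bullet> (a - c)) * (x \<bullet> b) \<le> \<bar>x \<bullet> (a - c)\<bar> * \<bar>x \<bullet> b\<bar>"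
      by (metis abs_ge_self abs_mult)
    also have "\<dots> \<le> (norm x * norm (a - c)) * (norm x * norm b)"
      by (intro mult_mono Cauchy_Schwarz_ineq2) auto
    also have "\<dots> = N * (norm b * norm (a - c))"
      by (simp add: N_def power2_eq_square)
    finally have "2 * t * ((x \<bullet> (a - c)) * (x \<bullet> b)) \<le> 2 * t * (N * (norm b * norm (a - c)))"
      using t by simp
    moreover have "0 \<le> (t * (x \<bullet> b) - x \<bullet> c)\<^sup>2" by simp
    ultimately show ?thesis
      by (simp add: inner_diff_right inner_commute[of b] power2_eq_square algebra_simps)
  qed
  have "2 * t * N = (\<integral>w. 2 * t * ((x \<bullet> fst w) * (fst (snd w) \<bullet> x)) \<partial>\<pi>)"
    by (simp add: N)
  also have "\<dots> \<le> (\<integral>w. t\<^sup>2 * (x \<bullet> fst (snd w))\<^sup>2 + (x \<bullet> snd (snd w))\<^sup>2 + 2 * t * N * ?d w \<partial>\<pi>)"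
    by (intro integral_mono pointwise integrable_mult_right Bochner_Integration.integrable_add
        int_N int_DN int_I int_s)
  also have "\<dots> = t\<^sup>2 * (\<integral>w. (x \<bullet> fst (snd w))\<^sup>2 \<partial>\<pi>) + I + 2 * t * N * s"
    by (simp add: int_N int_DN int_I int_s s I_def)
  also have "\<dots> \<le> t\<^sup>2 * (D * N) + I + 2 * t * N * s"
    using DN by (simp add: mult_left_mono)
  finally have "2 * t * (1 - s) * N - t\<^sup>2 * D * N \<le> I"
    by (simp add: algebra_simps)
  also have "2 * t * (1 - s) * N - t\<^sup>2 * D * N = (1 - s)\<^sup>2 / D * N"
    using D by (simp add: t_def field_simps power2_eq_square)
  finally show ?thesis
    unfolding I N_def[symmetric] by (rule ennreal_leI)
qed

text \<open>At a unit vector the frame integral lies between the two bounds, so the lower one does not exceed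
the upper one.\<close>

lemma frame_bounds_of_upper_bound:
  fixes \<nu> \<eta> :: "(real ^ 'n) measure"
  assumes dual: "prob_dual_frame \<mu> \<nu> \<gamma>12"
    and \<eta>: "\<eta> \<in> borel_probs2"
    and \<gamma>23: "\<gamma>23 \<in> couplings \<nu> \<eta>"
    and \<pi>: "\<pi> \<in> gluings \<gamma>12 \<gamma>23"
    and \<sigma>: "(\<integral>\<^sup>+ (x, y, z). ennreal (norm y * norm (x - z)) \<partial>\<pi>) = ennreal s" "0 \<le> s" "s < 1"
    and D: "0 < D" "\<And>x. (\<integral>\<^sup>+ y. ennreal (\<bar>x \<bullet> y\<bar>\<^sup>2) \<partial>\<nu>) \<le> ennreal (D * (norm x)\<^sup>2)"
  shows "prob_frame_bounds \<eta> ((1 - s)\<^sup>2 / D) (enn2real (second_moment \<eta>))"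
proof -
  note lower = frame_lower_bound[OF dual \<eta> \<gamma>23 \<pi> \<sigma> D]
  note upper = nn_integral_inner_sq_le_second_moment[OF \<eta>]
  obtain e :: "real ^ 'n" where e: "norm e = 1"
    using vector_choose_size[of 1] by auto
  have "ennreal ((1 - s)\<^sup>2 / D) \<le> ennreal (enn2real (second_moment \<eta>))"
    using order_trans[OF lower upper, of e] by (simp add: e)
  then have "(1 - s)\<^sup>2 / D \<le> enn2real (second_moment \<eta>)"
    by (simp add: ennreal_le_iff)
  then show ?thesis
    using \<eta> \<sigma> D(1) lower upper by (auto simp: prob_frame_bounds_def borel_probs2_def)
qed

text \<open>If the second moment of \<open>\<nu>\<close> vanished, every \<open>D > 0\<close> would be admissible in the previous lemma, and
the lower frame bounds \<open>(1 - s)\<^sup>2 / D\<close> of \<open>\<eta>\<close> would exceed the second moment of \<open>\<eta>\<close> for small \<open>D\<close>.\<close>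

lemma dual_second_moment_pos:
  fixes \<nu> \<eta> :: "(real ^ 'n) measure"
  assumes dual: "prob_dual_frame \<mu> \<nu> \<gamma>12"
    and \<eta>: "\<eta> \<in> borel_probs2"
    and \<gamma>23: "\<gamma>23 \<in> couplings \<nu> \<eta>"
    and \<pi>: "\<pi> \<in> gluings \<gamma>12 \<gamma>23"
    and \<sigma>: "(\<integral>\<^sup>+ (x, y, z). ennreal (norm y * norm (x - z)) \<partial>\<pi>) = ennreal s" "0 \<le> s" "s < 1"
  shows "0 < enn2real (second_moment \<nu>)"
proof (rule ccontr)
  \<comment> \<open>Chosen so that \<open>(1 - s)\<^sup>2 / D\<close> is the second moment plus 1.\<close>
  define D where "D = (1 - s)\<^sup>2 / (enn2real (second_moment \<eta>) + 1)"
  have D: "0 < D" using \<sigma> by (auto simp: D_def intro!: divide_pos_pos add_nonneg_pos)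
  assume "\<not> ?thesis"
  then have 0: "enn2real (second_moment \<nu>) = 0"
    using enn2real_nonneg[of "second_moment \<nu>"] by linarith
  have \<nu>: "\<nu> \<in> borel_probs2" using dual by (simp add: prob_dual_frame_def)
  have "(\<integral>\<^sup>+ y. ennreal (\<bar>x \<bullet> y\<bar>\<^sup>2) \<partial>\<nu>) \<le> ennreal (D * (norm x)\<^sup>2)" for x
    using nn_integral_inner_sq_le_second_moment[OF \<nu>, of x] by (simp add: 0)
  from frame_bounds_of_upper_bound[OF dual \<eta> \<gamma>23 \<pi> \<sigma> D this]
  have "(1 - s)\<^sup>2 / D \<le> enn2real (second_moment \<eta>)"
    by (simp add: prob_frame_bounds_def)
  moreover have "(1 - s)\<^sup>2 / D = enn2real (second_moment \<eta>) + 1"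
    using \<sigma> by (simp add: D_def)
  ultimately show False by simp
qed

theorem theorem3p5:
  fixes \<mu> \<nu> \<eta> :: "(real ^ 'n) measure"
    and \<gamma>12 \<gamma>23 :: "((real ^ 'n) \<times> (real ^ 'n)) measure"
  assumes "prob_frame \<mu>"
    and "\<nu> \<in> borel_probs2"
    and "\<gamma>12 \<in> couplings \<mu> \<nu>"
    and "prob_dual_frame \<mu> \<nu> \<gamma>12"
    and "\<eta> \<in> borel_probs2"
    and "\<gamma>23 \<in> couplings \<nu> \<eta>"
  shows "(\<exists>\<pi>. \<pi> \<in> gluings \<gamma>12 \<gamma>23) \<and>
    (\<forall>\<pi> \<in> gluings \<gamma>12 \<gamma>23.
      let \<sigma> = (\<integral>\<^sup>+ (x, y, z). ennreal (norm y * norm (x - z)) \<partial>\<pi>) in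
      \<sigma> < 1 \<longrightarrow>
        prob_frame_bounds \<eta> ((1 - enn2real \<sigma>)\<^sup>2 / enn2real (second_moment \<nu>))
          (enn2real (second_moment \<eta>)) \<and>
        (\<forall>D > 0. upper_frame_bound \<nu> D \<longrightarrow>
           prob_frame_bounds \<eta> ((1 - enn2real \<sigma>)\<^sup>2 / D) (enn2real (second_moment \<eta>))))"
proof (intro conjI ballI)
  show "\<exists>\<pi>. \<pi> \<in> gluings \<gamma>12 \<gamma>23"
    by (rule gluings_nonempty[OF assms(3,6)])
next
  fix \<pi> assume \<pi>: "\<pi> \<in> gluings \<gamma>12 \<gamma>23"
  note dual = assms(4) and \<eta> = assms(5) and \<gamma>23 = assms(6)
  show "let \<sigma> = (\<integral>\<^sup>+ (x, y, z). ennreal (norm y * norm (x - z)) \<partial>\<pi>) in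
      \<sigma> < 1 \<longrightarrow>
        prob_frame_bounds \<eta> ((1 - enn2real \<sigma>)\<^sup>2 / enn2real (second_moment \<nu>))
          (enn2real (second_moment \<eta>)) \<and>
        (\<forall>D > 0. upper_frame_bound \<nu> D \<longrightarrow>
           prob_frame_bounds \<eta> ((1 - enn2real \<sigma>)\<^sup>2 / D) (enn2real (second_moment \<eta>)))"
    unfolding Let_def
  proof (intro impI)
    define \<sigma> where "\<sigma> = (\<integral>\<^sup>+ (x, y, z). ennreal (norm y * norm (x - z)) \<partial>\<pi>)"
    assume "(\<integral>\<^sup>+ (x, y, z). ennreal (norm y * norm (x - z)) \<partial>\<pi>) < 1"
    then have "\<sigma> < 1" by (simp add: \<sigma>_def)
    then obtain s where s: "\<sigma> = ennreal s" "0 \<le> s" "s < 1"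
      by (cases \<sigma>) (auto simp: ennreal_less_one_iff)
    note \<sigma>s = s(1)[unfolded \<sigma>_def] s(2,3)
    note * = dual \<eta> \<gamma>23 \<pi> \<sigma>s
    have "\<nu> \<in> borel_probs2" using dual by (simp add: prob_dual_frame_def)
    then show "prob_frame_bounds \<eta>
        ((1 - enn2real (\<integral>\<^sup>+ (x, y, z). ennreal (norm y * norm (x - z)) \<partial>\<pi>))\<^sup>2 / enn2real (second_moment \<nu>))
        (enn2real (second_moment \<eta>)) \<and>
      (\<forall>D > 0. upper_frame_bound \<nu> D \<longrightarrow>
         prob_frame_bounds \<eta> ((1 - enn2real (\<integral>\<^sup>+ (x, y, z). ennreal (norm y * norm (x - z)) \<partial>\<pi>))\<^sup>2 / D)
           (enn2real (second_moment \<eta>)))"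
      unfolding \<sigma>s(1) enn2real_ennreal[OF s(2)]
      by (auto intro!: frame_bounds_of_upper_bound[OF *] dual_second_moment_pos[OF *]
          nn_integral_inner_sq_le_second_moment simp: upper_frame_bound_def prob_frame_bounds_def[of \<nu>])
  qed
qed

end
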